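(* Let $a,b,m$ be any integers such that $1\le a<b\le m$. For any real numbers $x\ge 1$, $y\ge 0$ and any integer $n\ge 0$, we have $$p_{n}(a,b,m; x,y)\ge p_{n}(b,a,m; x,y).$$
   Context: A partition $\lambda$ is a finite nonincreasing sequence of positive integers (its parts), possibly empty; $\ell(\lambda)$ is its number of parts and $|\lambda|$ the sum of its parts (so $\ell(\varnothing)=|\varnothing|=0$). $\mathcal{P}$ is the set of all partitions and $\mathcal{D}$ the set of all partitions with pairwise distinct parts. For integers $m\ge 1$ and $1\le c\le m$, $\ell_{c,m}(\lambda)$ is the number of parts of $\lambda$ congruent to $c$ modulo $m$, and $\ell_{c,m}(\lambda,\mu):=\ell_{c,m}(\lambda)+\ell_{c,m}(\mu)$ for $(\lambda,\mu)\in\mathcal{P}\times\mathcal{D}$. For residues $a\neq b$ in $\{1,\dots,m\}$, real $x,y\ge 0$ and integer $n\ge 0$, define $$p_{n}(a,b,m; x,y):=\sum_{\substack{(\lambda, \mu)\in\mathcal{P}\times \mathcal{D}\\ |\lambda|+|\mu|=n\\ \ell_{a,m}(\lambda,\mu)> \ell_{b,m}(\lambda,\mu)}} x^{\ell(\lambda)}y^{\ell(\mu)},$$ with the convention $0^0=1$. *)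

theory Defs
  imports Complex_Main "HOL-Number_Theory.Cong"
begin

definition partitions :: "nat list set" where
  "partitions = {xs. sorted_wrt (\<ge>) xs \<and> (\<forall>k\<in>set xs. 0 < k)}"

definition distinct_partitions :: "nat list set" where
  "distinct_partitions = {xs \<in> partitions. distinct xs}"

definition num_parts_cong :: "nat \<Rightarrow> nat \<Rightarrow> nat list \<Rightarrow> nat" where
  "num_parts_cong c m xs = length (filter (\<lambda>k. [k = c] (mod m)) xs)"

definition num_parts_cong_pair :: "nat \<Rightarrow> nat \<Rightarrow> nat list \<times> nat list \<Rightarrow> nat" where
  "num_parts_cong_pair c m = (\<lambda>(xs, ys). num_parts_cong c m xs + num_parts_cong c m ys)"

definition biased_pairs :: "nat \<Rightarrow> nat \<Rightarrow> nat \<Rightarrow> nat \<Rightarrow> (nat list \<times> nat list) set" where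
  "biased_pairs n a b m =
     {(xs, ys). (xs, ys) \<in> partitions \<times> distinct_partitions \<and>
        sum_list xs + sum_list ys = n \<and>
        num_parts_cong_pair a m (xs, ys) > num_parts_cong_pair b m (xs, ys)}"

(* The power is the one with natural exponent, so 0 ^ 0 = 1. *)
definition biased_sum :: "nat \<Rightarrow> nat \<Rightarrow> nat \<Rightarrow> nat \<Rightarrow> real \<Rightarrow> real \<Rightarrow> real" where
  "biased_sum n a b m x y =
     (\<Sum>(xs, ys)\<in>biased_pairs n a b m. x ^ length xs * y ^ length ys)"

lemma length_le_sum_list_pos:
  fixes xs :: "nat list"
  assumes "\<forall>k\<in>set xs. 0 < k"
  shows "length xs \<le> sum_list xs"
  using assms by (induction xs) auto

(* Finiteness of the index set: the sum above is a genuine one. *)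
lemma finite_biased_pairs: "finite (biased_pairs n a b m)"
proof -
  let ?L = "{xs. set xs \<subseteq> {..n} \<and> length xs \<le> n}"
  have "xs \<in> ?L" if "xs \<in> partitions" "sum_list xs \<le> n" for xs
  proof -
    have "length xs \<le> n"
      using that length_le_sum_list_pos[of xs] by (auto simp: partitions_def)
    moreover have "k \<le> n" if "k \<in> set xs" for k
      using member_le_sum_list[OF that] \<open>sum_list xs \<le> n\<close> by linarith
    ultimately show ?thesis by auto
  qed
  then have "biased_pairs n a b m \<subseteq> ?L \<times> ?L"
    unfolding biased_pairs_def distinct_partitions_def by fastforce
  moreover have "finite (?L \<times> ?L)"
    using finite_lists_length_le[of "{..n}" n] by blast
  ultimately show ?thesis by (rule finite_subset)
qed

end

theory Submission
  imports Defs "HOL-Library.Multiset"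
begin

text \<open>
  It suffices to inject the pairs with more parts congruent to \<open>b\<close> into those with more parts
  congruent to \<open>a\<close>, keeping the length of the second component and not decreasing that of the
  first. If there are \<open>d > 0\<close> more parts congruent to \<open>b\<close>, exchange the two residue classes by
  \<open>a + m u \<leftrightarrow> b + m u\<close>, which lowers the size by \<open>d (b - a)\<close>, and compensate by adding \<open>d\<close>
  parts \<open>b - a\<close> to the first component. Such a part is never congruent to \<open>b\<close>, and is congruent
  to \<open>a\<close> only if \<open>b = 2 a\<close>; so the surplus of parts congruent to \<open>a\<close> becomes \<open>d\<close>, or \<open>2 d\<close> if
  \<open>b = 2 a\<close>. Either way it determines \<open>d\<close>, and the map can be undone.
\<close>

text \<open>Exchanging residue classes does not preserve the order of parts, so the resulting lists
  have to be sorted again.\<close>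

definition sort_desc :: "nat list \<Rightarrow> nat list" where
  "sort_desc xs = rev (sort xs)"

lemma mset_sort_desc [simp]: "mset (sort_desc xs) = mset xs"
  by (simp add: sort_desc_def)

lemma length_sort_desc [simp]: "length (sort_desc xs) = length xs"
  by (simp add: sort_desc_def)

lemma distinct_sort_desc [simp]: "distinct (sort_desc xs) = distinct xs"
  by (simp add: sort_desc_def)

lemma sum_list_sort_desc [simp]: "sum_list (sort_desc xs) = sum_list xs"
  by (metis mset_sort_desc sum_mset_sum_list)

lemma sort_desc_in_partitions: "\<forall>k\<in>set xs. 0 < k \<Longrightarrow> sort_desc xs \<in> partitions"
  by (simp add: partitions_def sort_desc_def sorted_wrt_rev)

lemma partitions_mset_eqD:
  assumes "xs \<in> partitions" "ys \<in> partitions" "mset xs = mset ys"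
  shows "xs = ys"
proof -
  have "sorted (rev xs)" "sorted (rev ys)"
    using assms(1,2) by (simp_all add: partitions_def sorted_wrt_rev)
  then have "rev xs = rev ys"
    using assms(3) by (metis mset_rev properties_for_sort)
  then show ?thesis by simp
qed

lemma num_parts_cong_mset: "num_parts_cong c m xs = size (filter_mset (\<lambda>k. [k = c] (mod m)) (mset xs))"
  by (metis mset_filter num_parts_cong_def size_mset)

lemma num_parts_cong_sort_desc [simp]: "num_parts_cong c m (sort_desc xs) = num_parts_cong c m xs"
  by (simp add: num_parts_cong_mset)

lemma num_parts_cong_append [simp]:
  "num_parts_cong c m (xs @ ys) = num_parts_cong c m xs + num_parts_cong c m ys"
  by (simp add: num_parts_cong_def)

lemma num_parts_cong_replicate [simp]:
  "num_parts_cong c m (replicate d k) = (if [k = c] (mod m) then d else 0)"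
  by (simp add: num_parts_cong_def)

locale residue_pair =
  fixes a b m :: nat
  assumes a_pos: "1 \<le> a" and a_less_b: "a < b" and b_le_m: "b \<le> m"
begin

text \<open>Modulo \<open>m\<close>, \<open>a\<close> reduces to itself and is nonzero, while
  \<open>b\<close> reduces to itself or, if \<open>b = m\<close>, to 0.\<close>

lemma not_cong_both: "[k = a] (mod m) \<Longrightarrow> \<not> [k = b] (mod m)"
  using a_pos a_less_b b_le_m unfolding cong_def
  by (metis le_neq_implies_less less_irrefl_nat mod_less mod_self not_one_le_zero order.strict_trans2)

text \<open>If \<open>k < b\<close>, then \<open>k\<close> is its own residue, while
  \<open>b\<close> has residue \<open>b\<close>, or 0 if \<open>b = m\<close>; both are impossible
  for positive \<open>k\<close>. Hence subtracting \<open>b - a\<close> from such a part never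
  truncates and leaves at least \<open>a\<close>.\<close>

lemma cong_b_ge:
  assumes "[k = b] (mod m)" "0 < k"
  shows "b \<le> k"
proof (rule ccontr)
  assume "\<not> b \<le> k"
  then have "k mod m = k" "k < b"
    using b_le_m by auto
  then show False
    using assms b_le_m by (cases "b = m") (auto simp: cong_def)
qed

definition swap_part :: "nat \<Rightarrow> nat" where
  "swap_part k = (if [k = a] (mod m) then k + (b - a)
                  else if [k = b] (mod m) then k - (b - a) else k)"

lemma cong_a_shift: "[k + (b - a) = b] (mod m) \<longleftrightarrow> [k = a] (mod m)"
  using cong_add_rcancel_nat[of k "b - a" a m] a_less_b by simp

lemma cong_b_shift:
  assumes "[k = b] (mod m)" "0 < k"
  shows "[k - (b - a) = a] (mod m)"
  using assms cong_a_shift[of "k - (b - a)"] cong_b_ge[OF assms] by simp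

lemma swap_part_pos: "0 < k \<Longrightarrow> 0 < swap_part k"
  using cong_b_ge[of k] a_pos a_less_b by (auto simp: swap_part_def)

lemma swap_part_swap_part: "0 < k \<Longrightarrow> swap_part (swap_part k) = k"
  using cong_a_shift[of k] cong_b_shift[of k] cong_b_ge[of k] not_cong_both
  by (auto simp: swap_part_def)

lemma swap_part_cong_a: "0 < k \<Longrightarrow> [swap_part k = a] (mod m) \<longleftrightarrow> [k = b] (mod m)"
  using cong_a_shift[of k] cong_b_shift[of k] not_cong_both
  by (auto simp: swap_part_def)

lemma swap_part_cong_b: "0 < k \<Longrightarrow> [swap_part k = b] (mod m) \<longleftrightarrow> [k = a] (mod m)"
  using cong_a_shift[of k] cong_b_shift[of k] not_cong_both
  by (auto simp: swap_part_def)

lemma num_parts_cong_map_swap_part: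
  assumes "\<forall>k\<in>set xs. 0 < k"
  shows "num_parts_cong a m (map swap_part xs) = num_parts_cong b m xs"
    and "num_parts_cong b m (map swap_part xs) = num_parts_cong a m xs"
  using assms
  by (induction xs) (auto simp: num_parts_cong_def swap_part_cong_a swap_part_cong_b)

text \<open>Each part in the class of \<open>a\<close> gains \<open>b - a\<close> and each part in
  the class of \<open>b\<close> loses it. Losses stand on the left to avoid truncated
  subtraction.\<close>

lemma sum_list_map_swap_part:
  assumes "\<forall>k\<in>set xs. 0 < k"
  shows "sum_list (map swap_part xs) + num_parts_cong b m xs * (b - a)
       = sum_list xs + num_parts_cong a m xs * (b - a)"
  using assms
proof (induction xs)
  case (Cons k xs)
  have "swap_part k + (if [k = b] (mod m) then b - a else 0)
      = k + (if [k = a] (mod m) then b - a else 0)"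
    using Cons.prems cong_b_ge[of k] not_cong_both[of k] by (auto simp: swap_part_def)
  then show ?case
    using Cons by (simp add: num_parts_cong_def split: if_splits)
qed (simp add: num_parts_cong_def)

lemma inj_on_swap_part: "inj_on swap_part {k. 0 < k}"
  by (metis inj_on_inverseI mem_Collect_eq swap_part_swap_part)

text \<open>Applying the involution \<open>swap_part\<close> once more recovers the multiset of
  parts, which determines a partition.\<close>

lemma mset_map_swap_part_eqD:
  assumes "mset (map swap_part xs) = mset (map swap_part ys)"
    and "xs \<in> partitions" "ys \<in> partitions"
  shows "xs = ys"
proof -
  have "mset (map swap_part (map swap_part zs)) = mset zs" if "zs \<in> partitions" for zs
    using that by (simp add: partitions_def swap_part_swap_part map_idI)
  then show ?thesis
    using assms by (metis mset_map partitions_mset_eqD)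
qed

text \<open>On \<open>biased_pairs n b a m\<close> the subtraction does not truncate and the value
  is positive.\<close>

definition surplus :: "nat list \<times> nat list \<Rightarrow> nat" where
  "surplus p = num_parts_cong_pair b m p - num_parts_cong_pair a m p"

text \<open>The new parts are all equal, so they go to the first component, where repetition is
  allowed.\<close>

definition exchange :: "nat list \<times> nat list \<Rightarrow> nat list \<times> nat list" where
  "exchange p = (sort_desc (map swap_part (fst p) @ replicate (surplus p) (b - a)),
                 sort_desc (map swap_part (snd p)))"

text \<open>Both \<open>b - a\<close> and \<open>a\<close> are less than \<open>m\<close>, so
  congruence means equality.\<close>

lemma difference_cong_a: "[b - a = a] (mod m) \<longleftrightarrow> b = 2 * a"
  using a_pos a_less_b b_le_m by (auto simp: cong_def)

text \<open>The number \<open>b - a\<close> is positive but smaller than \<open>b\<close>, the least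
  positive member of its class.\<close>

lemma difference_not_cong_b: "\<not> [b - a = b] (mod m)"
  using cong_b_ge[of "b - a"] a_pos a_less_b by auto

lemma biased_pairs_pos:
  assumes "(xs, ys) \<in> biased_pairs n c d m"
  shows "\<forall>k\<in>set xs. 0 < k" "\<forall>k\<in>set ys. 0 < k"
  using assms by (auto simp: biased_pairs_def distinct_partitions_def partitions_def)

text \<open>The swap interchanges the two counts; the added parts raise only the count for
  \<open>a\<close>, and only if \<open>b = 2 * a\<close>.\<close>

lemma num_parts_cong_pair_exchange:
  assumes "p \<in> biased_pairs n b a m"
  shows "num_parts_cong_pair a m (exchange p)
       = num_parts_cong_pair b m (exchange p) + (if b = 2 * a then 2 else 1) * surplus p"
proof -
  obtain xs ys where p: "p = (xs, ys)" by force
  note pos = biased_pairs_pos[OF assms[unfolded p]]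
  have "num_parts_cong_pair b m p = num_parts_cong_pair a m p + surplus p"
    using assms by (auto simp: biased_pairs_def surplus_def)
  moreover have "num_parts_cong_pair a m (exchange p)
      = num_parts_cong_pair b m p + (if b = 2 * a then surplus p else 0)"
    by (simp add: exchange_def num_parts_cong_pair_def num_parts_cong_map_swap_part pos
        difference_cong_a p)
  moreover have "num_parts_cong_pair b m (exchange p) = num_parts_cong_pair a m p"
    by (simp add: exchange_def num_parts_cong_pair_def num_parts_cong_map_swap_part pos
        difference_not_cong_b p)
  ultimately show ?thesis by simp
qed

lemma exchange_in_biased_pairs:
  assumes "p \<in> biased_pairs n b a m"
  shows "exchange p \<in> biased_pairs n a b m"
proof -
  obtain xs ys where p: "p = (xs, ys)" by force
  note pos = biased_pairs_pos[OF assms[unfolded p]]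
  have "0 < surplus p"
    using assms by (auto simp: biased_pairs_def surplus_def)
  then have more: "num_parts_cong_pair a m (exchange p) > num_parts_cong_pair b m (exchange p)"
    using num_parts_cong_pair_exchange[OF assms] by simp
  have "num_parts_cong b m xs + num_parts_cong b m ys
      = num_parts_cong a m xs + num_parts_cong a m ys + surplus p"
    using assms by (auto simp: p biased_pairs_def surplus_def num_parts_cong_pair_def)
  then have "num_parts_cong b m xs * (b - a) + num_parts_cong b m ys * (b - a)
      = num_parts_cong a m xs * (b - a) + num_parts_cong a m ys * (b - a) + surplus p * (b - a)"
    by (metis add_mult_distrib)
  \<comment> \<open>The swap lowers the total size by exactly the size of the added parts.\<close>
  then have "sum_list (map swap_part xs) + surplus p * (b - a) + sum_list (map swap_part ys)
      = sum_list xs + sum_list ys"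
    using sum_list_map_swap_part[OF pos(1)] sum_list_map_swap_part[OF pos(2)] by linarith
  then have size: "sum_list (fst (exchange p)) + sum_list (snd (exchange p)) = n"
    using assms by (simp add: p exchange_def sum_list_replicate biased_pairs_def)
  have "fst (exchange p) \<in> partitions" "snd (exchange p) \<in> partitions"
    using pos swap_part_pos a_less_b by (auto simp: p exchange_def intro!: sort_desc_in_partitions)
  moreover have "distinct (map swap_part ys)"
    using assms pos(2) inj_on_subset[OF inj_on_swap_part]
    by (auto simp: p biased_pairs_def distinct_partitions_def distinct_map)
  then have "distinct (snd (exchange p))"
    by (simp add: p exchange_def)
  ultimately show ?thesis
    using more size by (cases "exchange p") (simp add: biased_pairs_def distinct_partitions_def)
qed

lemma inj_on_exchange: "inj_on exchange (biased_pairs n b a m)"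
proof (rule inj_onI)
  fix p q
  assume p: "p \<in> biased_pairs n b a m" and q: "q \<in> biased_pairs n b a m"
    and eq: "exchange p = exchange q"
  \<comment> \<open>The factor 1 or 2 depends on \<open>a\<close> and \<open>b\<close> alone, so the
    common image determines the surplus.\<close>
  have d: "surplus p = surplus q"
    using num_parts_cong_pair_exchange[OF p] num_parts_cong_pair_exchange[OF q] eq
    by (simp split: if_splits)
  have "mset (fst (exchange p)) = mset (fst (exchange q))"
    "mset (snd (exchange p)) = mset (snd (exchange q))"
    using eq by simp_all
  \<comment> \<open>Equal surpluses mean equal blocks of added parts, which cancel.\<close>
  then have "mset (map swap_part (fst p)) = mset (map swap_part (fst q))"
    "mset (map swap_part (snd p)) = mset (map swap_part (snd q))"
    by (simp_all add: exchange_def d)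
  moreover have "fst p \<in> partitions" "snd p \<in> partitions" "fst q \<in> partitions" "snd q \<in> partitions"
    using p q by (auto simp: biased_pairs_def distinct_partitions_def)
  ultimately show "p = q"
    by (simp add: mset_map_swap_part_eqD prod_eq_iff)
qed

end

theorem theorem1p1:
  fixes a b m n :: nat and x y :: real
  assumes "1 \<le> a" and "a < b" and "b \<le> m" and "x \<ge> 1" and "y \<ge> 0"
  shows "biased_sum n a b m x y \<ge> biased_sum n b a m x y"
proof -
  interpret residue_pair a b m
    using assms by unfold_locales
  define w where "w = (\<lambda>p :: nat list \<times> nat list. x ^ length (fst p) * y ^ length (snd p))"
  have biased_sum_w: "biased_sum n c d m x y = sum w (biased_pairs n c d m)" for c d
    by (simp add: biased_sum_def w_def case_prod_beta)
  have nonneg: "0 \<le> w p" for p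
    using assms by (simp add: w_def)
  \<comment> \<open>The first component gains \<open>surplus p\<close> parts, each a factor
    \<open>x \<ge> 1\<close>; the second keeps its length.\<close>
  have "w p \<le> w (exchange p)" for p
    using assms by (auto simp: w_def exchange_def intro!: mult_right_mono power_increasing)
  then have "sum w (biased_pairs n b a m) \<le> sum (w \<circ> exchange) (biased_pairs n b a m)"
    by (simp add: sum_mono)
  also have "\<dots> = sum w (exchange ` biased_pairs n b a m)"
    by (rule sum.reindex[OF inj_on_exchange, symmetric])
  \<comment> \<open>Pairs outside the image contribute nonnegative weights.\<close>
  also have "\<dots> \<le> sum w (biased_pairs n a b m)"
    using exchange_in_biased_pairs nonneg by (intro sum_mono2 finite_biased_pairs) auto
  finally show ?thesis
    by (simp add: biased_sum_w)
qed

end
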